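(* Let $f:\mathbb{R}\to\mathbb{R}$ be continuously differentiable, let $\alpha\in(0,1]$, $p>0$, $L>0$, and suppose $f$ is $(L,p)$-Hölder smooth. Then for all $x,c\in\mathbb{R}$ with $x\neq c$, $$\left|\frac{f'(x)(x-c)}{\Gamma(2-\alpha)|x-c|^{\alpha}}-{}^{C}D^{\alpha}_{c}f(x)\right|\le\frac{L}{\Gamma(1-\alpha)(1+p-\alpha)}|x-c|^{1+p-\alpha}.$$
   Context: $f:\mathbb{R}\to\mathbb{R}$ is $(L,p)$-Hölder smooth ($p>0$) if $|f(y)-f(x)-f'(x)(y-x)|\le\frac{L}{1+p}|y-x|^{1+p}$ for all $x,y\in\mathbb{R}$. $\Gamma$ is the gamma function. For $0<\alpha<1$ and $x\ne c$ (either $x>c$ or $x<c$), the Caputo derivative of order $\alpha$ with terminal $c$ is $${}^{C}D^{\alpha}_{c}f(x)=\frac{1}{\Gamma(1-\alpha)}\int_c^x\frac{f'(t)}{|x-t|^{\alpha}}\,dt,$$ where $\int_c^x$ is the oriented integral. Convention at $\alpha=1$: ${}^{C}D^{1}_{c}f(x)$ is the limiting value $\operatorname{sgn}(x-c)f'(x)$, where $\operatorname{sgn}$ is the sign function, and $1/\Gamma(1-\alpha)=1/\Gamma(0)$ is read as $0$. *)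

theory Defs
  imports "HOL-Analysis.Analysis"
begin

definition Holder_smooth :: "real \<Rightarrow> real \<Rightarrow> (real \<Rightarrow> real) \<Rightarrow> bool" where
  "Holder_smooth L p f \<longleftrightarrow>
     (\<forall>x y. \<bar>f y - f x - deriv f x * (y - x)\<bar> \<le> L / (1 + p) * \<bar>y - x\<bar> powr (1 + p))"

text \<open>
  Caputo derivative of order \<open>\<alpha> \<in> (0, 1]\<close> with terminal \<open>c\<close>, for \<open>x \<noteq> c\<close> on either side of
  \<open>c\<close>.  The interval integral is oriented: for \<open>x < c\<close> it is minus the integral over \<open>(x, c)\<close>.
  The value at \<open>\<alpha> = 1\<close> is the limiting one, fixed by convention.
\<close>
definition caputo_deriv :: "real \<Rightarrow> real \<Rightarrow> (real \<Rightarrow> real) \<Rightarrow> real \<Rightarrow> real" where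
  "caputo_deriv \<alpha> c f x =
     (if \<alpha> = 1 then sgn (x - c) * deriv f x
      else 1 / Gamma (1 - \<alpha>) *
        (LBINT t=ereal c..ereal x. deriv f t / \<bar>x - t\<bar> powr \<alpha>))"

end

theory Submission
  imports Defs
begin

text \<open>
  Put \<open>d = \<bar>x - c\<bar>\<close> and \<open>s = sgn (x - c)\<close>, and parametrise the segment from \<open>x\<close> to \<open>c\<close> by the distance
  \<open>u\<close> to \<open>x\<close>, that is \<open>t = x - s * u\<close>.  For \<open>\<alpha> < 1\<close> the functional equation of the Gamma function
  turns the first term of the claim into the Caputo derivative of the tangent line of \<open>f\<close> at \<open>x\<close>,
  and the difference becomes \<open>s / Gamma (1 - \<alpha>)\<close> times the integral of
  \<open>(f' x - f' (x - s * u)) / u powr \<alpha>\<close> over \<open>[0, d]\<close>.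

  Adding the smoothness inequality to the one with its two points exchanged bounds the difference of
  derivatives by \<open>2 * L / (1 + p) * u powr p\<close>, which for \<open>p < 1\<close> is too weak by the factor
  \<open>2 / (1 + p)\<close>.  Instead the integral is taken by parts: an antiderivative of \<open>f' x - f' (x - s * u)\<close> is, up
  to sign, the remainder \<open>\<phi>\<close> of the tangent line approximation at \<open>x\<close>, and Hoelder smoothness says
  exactly that \<open>\<bar>\<phi> u\<bar> \<le> K * u powr (1 + p)\<close> with \<open>K = L / (1 + p)\<close>.  The boundary term is then at
  most \<open>K * d powr (1 + p - \<alpha>)\<close> and the remaining integral at most
  \<open>\<alpha> * K / (1 + p - \<alpha>) * d powr (1 + p - \<alpha>)\<close>; the two constants add up to
  \<open>K * (1 + p) / (1 + p - \<alpha>) = L / (1 + p - \<alpha>)\<close>.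
  This is \<open>weighted_integral_deriv_bound\<close>.

  For \<open>\<alpha> = 1\<close> both sides of the claim vanish.
\<close>

text \<open>
  The weight is nonnegative and has an elementary integral, so it is Lebesgue integrable despite its
  singularity at \<open>0\<close>; a continuous factor on a compact interval is bounded and preserves this.
\<close>
lemma set_integrable_continuous_div_powr:
  fixes h :: "real \<Rightarrow> real"
  assumes "continuous_on {0..d} h" and "a < 1" and "0 \<le> d"
  shows "set_integrable lborel {0..d} (\<lambda>u. h u / u powr a)"
proof -
  have "(\<lambda>u. u powr (-a)) integrable_on {0..d}"
    using has_integral_powr_from_0[of "-a" d] assms by (auto simp: integrable_on_def)
  then have weight: "(\<lambda>u. u powr (-a)) absolutely_integrable_on {0..d}"
    by (rule nonnegative_absolutely_integrable_1) auto
  have "(\<lambda>u. h u * u powr (-a)) absolutely_integrable_on {0..d}"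
  proof (rule absolutely_integrable_bounded_measurable_product_real[OF _ _ _ weight])
    show "h \<in> borel_measurable (lebesgue_on {0..d})"
      by (rule continuous_imp_measurable_on_sets_lebesgue) (use assms in auto)
    show "bounded (h ` {0..d})"
      by (intro compact_imp_bounded compact_continuous_image assms compact_Icc)
  qed auto
  then have int: "integrable lebesgue (\<lambda>u. indicator {0..d} u *\<^sub>R (h u * u powr (-a)))"
    by (simp add: set_integrable_def)
  have [measurable]: "(\<lambda>u. indicator {0..d} u *\<^sub>R h u) \<in> borel_measurable borel"
    using borel_measurable_continuous_on_indicator[OF _ assms(1)] by simp
  have "(\<lambda>u. (indicator {0..d} u *\<^sub>R h u) * u powr (-a)) \<in> borel_measurable borel"
    by measurable
  then have "(\<lambda>u. indicator {0..d} u *\<^sub>R (h u * u powr (-a))) \<in> borel_measurable lborel"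
    by (simp add: mult.assoc)
  then have "integrable lborel (\<lambda>u. indicator {0..d} u *\<^sub>R (h u * u powr (-a)))"
    using int integrable_completion by blast
  then show ?thesis
    by (simp add: set_integrable_def powr_minus divide_inverse)
qed

text \<open>
  Integration by parts against \<open>u powr (-a)\<close>: the bound on \<open>\<phi>\<close> kills the boundary term at \<open>0\<close> and
  controls both the boundary term at \<open>d\<close> and the integral of \<open>a * \<phi> u * u powr (-a - 1)\<close>.
\<close>
lemma weighted_integral_deriv_bound:
  fixes \<phi> h :: "real \<Rightarrow> real"
  assumes cont_h: "continuous_on {0..d} h" and cont_\<phi>: "continuous_on {0..d} \<phi>"
    and deriv: "\<And>u. 0 < u \<Longrightarrow> u < d \<Longrightarrow> (\<phi> has_real_derivative h u) (at u)"
    and bound: "\<And>u. 0 \<le> u \<Longrightarrow> u \<le> d \<Longrightarrow> \<bar>\<phi> u\<bar> \<le> K * u powr (1 + p)"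
    and a: "0 < a" "a < 1" and p: "0 < p" and d: "0 < d"
  shows "\<bar>integral {0..d} (\<lambda>u. h u / u powr a)\<bar> \<le> K * (1 + p) / (1 + p - a) * d powr (1 + p - a)"
proof -
  let ?F = "\<lambda>u. \<phi> u * u powr (-a)"
  let ?R = "\<lambda>u. a * \<phi> u * u powr (-a - 1)"
  have decay: "\<bar>\<phi> u * u powr b\<bar> \<le> K * u powr (1 + p + b)" if "0 \<le> u" "u \<le> d" for u b
    using mult_right_mono[OF bound[OF that], of "u powr b"]
    by (simp add: abs_mult powr_add mult.assoc)
  \<comment> \<open>Since \<open>0 powr (-a) = 0\<close>, the value of \<open>?F\<close> at \<open>0\<close> is also its limit there.\<close>
  have cont_F: "continuous_on {0..d} ?F"
    unfolding continuous_on_eq_continuous_within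
  proof
    fix u assume u: "u \<in> {0..d}"
    show "continuous (at u within {0..d}) ?F"
    proof (cases "u = 0")
      case True
      have "((\<lambda>v. v powr (1 + p - a)) \<longlongrightarrow> 0 powr (1 + p - a)) (at 0 within {0..d})"
        by (rule tendsto_powr') (use a p in \<open>auto simp: eventually_at_filter\<close>)
      then have lim: "((\<lambda>v. K * v powr (1 + p - a)) \<longlongrightarrow> 0) (at 0 within {0..d})"
        by (auto intro: tendsto_mult_right_zero)
      have "(?F \<longlongrightarrow> 0) (at 0 within {0..d})"
        by (rule Lim_null_comparison[OF _ lim])
           (use decay[of _ "-a"] in \<open>auto simp: eventually_at_filter\<close>)
      then show ?thesis
        using True by (simp add: continuous_within)
    next
      case False
      then show ?thesis
        using cont_\<phi> u unfolding continuous_on_eq_continuous_within continuous_within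
        by (auto intro!: tendsto_mult tendsto_powr)
    qed
  qed
  have F': "(?F has_real_derivative h u * u powr (-a) - ?R u) (at u)" if "u \<in> {0<..<d}" for u
    using that by (auto intro!: derivative_eq_intros deriv simp: algebra_simps)
  have FTC: "((\<lambda>u. h u * u powr (-a) - ?R u) has_integral ?F d - ?F 0) {0..d}"
    by (rule fundamental_theorem_of_calculus_interior[OF _ cont_F])
       (use F' d in \<open>auto simp: has_real_derivative_iff_has_vector_derivative\<close>)
  have "(\<lambda>u. h u / u powr a) integrable_on {0..d}"
    by (rule set_borel_integral_eq_integral(1)[OF set_integrable_continuous_div_powr])
       (use cont_h a d in auto)
  then have "((\<lambda>u. h u / u powr a) has_integral integral {0..d} (\<lambda>u. h u / u powr a)) {0..d}"
    by (rule integrable_integral)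
  then have H: "((\<lambda>u. h u * u powr (-a)) has_integral integral {0..d} (\<lambda>u. h u / u powr a)) {0..d}"
    by (simp add: powr_minus divide_inverse)
  have R: "(?R has_integral integral {0..d} (\<lambda>u. h u / u powr a) - ?F d) {0..d}"
    using has_integral_diff[OF H FTC] by simp
  have "((\<lambda>u. a * K * u powr (p - a)) has_integral
      a * K * (d powr (p - a + 1) / (p - a + 1))) {0..d}"
    by (rule has_integral_mult_right[OF has_integral_powr_from_0]) (use a p d in auto)
  then have majorant: "((\<lambda>u. a * K * u powr (p - a)) has_integral
      a * K / (1 + p - a) * d powr (1 + p - a)) {0..d}"
    by (simp add: algebra_simps)
  have "\<bar>?R u\<bar> \<le> a * K * u powr (p - a)" if "u \<in> {0..d}" for u
    using mult_left_mono[OF decay[of u "-a - 1"], of a] that a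
    by (simp add: abs_mult mult.assoc)
  then have "norm (integral {0..d} ?R) \<le> integral {0..d} (\<lambda>u. a * K * u powr (p - a))"
    by (intro integral_norm_bound_integral) (use R majorant in \<open>auto simp: integrable_on_def\<close>)
  then have "\<bar>integral {0..d} (\<lambda>u. h u / u powr a) - ?F d\<bar>
      \<le> a * K / (1 + p - a) * d powr (1 + p - a)"
    using integral_unique[OF R] integral_unique[OF majorant] by simp
  moreover have "\<bar>?F d\<bar> \<le> K * d powr (1 + p - a)"
    using decay[of d "-a"] d by simp
  ultimately have "\<bar>integral {0..d} (\<lambda>u. h u / u powr a)\<bar>
      \<le> a * K / (1 + p - a) * d powr (1 + p - a) + K * d powr (1 + p - a)"
    by linarith
  also have "\<dots> = K * (1 + p) / (1 + p - a) * d powr (1 + p - a)"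
    using a p by (simp add: field_simps)
  finally show ?thesis .
qed

text \<open>
  The substitution \<open>t = x - s * u\<close> treats both orientations at once: the reflection that occurs for
  \<open>c < x\<close> reverses the limits, and the sign \<open>s\<close> restores the orientation.
\<close>
lemma interval_integral_by_distance:
  fixes g :: "real \<Rightarrow> real" and x c :: real
  assumes "x \<noteq> c"
  shows "(LBINT t=ereal c..ereal x. g t)
    = sgn (x - c) * (LBINT u=ereal 0..ereal \<bar>x - c\<bar>. g (x - sgn (x - c) * u))"
proof (cases "c < x")
  case True
  have "(\<integral>t. indicator {c<..<x} t *\<^sub>R g t \<partial>lborel)
      = (\<integral>u. indicator {c<..<x} (x - u) *\<^sub>R g (x - u) \<partial>lborel)"
    using lborel_integral_real_affine[of "-1" "\<lambda>t. indicator {c<..<x} t *\<^sub>R g t" x] by simp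
  also have "\<dots> = (\<integral>u. indicator {0<..<x - c} u *\<^sub>R g (x - u) \<partial>lborel)"
    by (intro Bochner_Integration.integral_cong) (auto simp: indicator_def)
  finally show ?thesis
    using True by (simp add: interval_lebesgue_integral_def set_lebesgue_integral_def)
next
  case False
  then have less: "x < c" using assms by simp
  have "(\<integral>t. indicator {x<..<c} t *\<^sub>R g t \<partial>lborel)
      = (\<integral>u. indicator {x<..<c} (x + u) *\<^sub>R g (x + u) \<partial>lborel)"
    using lborel_integral_real_affine[of 1 "\<lambda>t. indicator {x<..<c} t *\<^sub>R g t" x] by simp
  also have "\<dots> = (\<integral>u. indicator {0<..<c - x} u *\<^sub>R g (x + u) \<partial>lborel)"
    by (intro Bochner_Integration.integral_cong) (auto simp: indicator_def)
  finally show ?thesis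
    using less by (simp add: interval_lebesgue_integral_def set_lebesgue_integral_def)
qed

lemma C1_differentiable_on_UNIV_real:
  fixes f :: "real \<Rightarrow> real"
  assumes "f C1_differentiable_on UNIV"
  shows "(f has_real_derivative deriv f x) (at x)" and "continuous_on A (deriv f)"
proof -
  obtain D where D: "\<And>x. (f has_real_derivative D x) (at x)" and cont: "continuous_on UNIV D"
    using assms by (auto simp: C1_differentiable_on_def has_real_derivative_iff_has_vector_derivative)
  have "deriv f = D"
    using D DERIV_imp_deriv by blast
  with D cont show "(f has_real_derivative deriv f x) (at x)" "continuous_on A (deriv f)"
    by (auto intro: continuous_on_subset)
qed

lemma caputo_deriv_by_distance:
  fixes f :: "real \<Rightarrow> real"
  assumes "f C1_differentiable_on UNIV" and "\<alpha> < 1" and "x \<noteq> c"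
  shows "caputo_deriv \<alpha> c f x = sgn (x - c) / Gamma (1 - \<alpha>) *
    integral {0..\<bar>x - c\<bar>} (\<lambda>u. deriv f (x - sgn (x - c) * u) / u powr \<alpha>)"
proof -
  define s d where "s = sgn (x - c)" and "d = \<bar>x - c\<bar>"
  have abs_s: "\<bar>s\<bar> = 1" and d: "0 < d"
    using assms(3) by (auto simp: s_def d_def sgn_if)
  have "(LBINT t=ereal c..ereal x. deriv f t / \<bar>x - t\<bar> powr \<alpha>)
      = s * (LBINT u=ereal 0..ereal d. deriv f (x - s * u) / \<bar>u\<bar> powr \<alpha>)"
    using interval_integral_by_distance[OF assms(3), of "\<lambda>t. deriv f t / \<bar>x - t\<bar> powr \<alpha>"] abs_s
    by (simp add: s_def[symmetric] d_def[symmetric] abs_mult)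
  also have "(LBINT u=ereal 0..ereal d. deriv f (x - s * u) / \<bar>u\<bar> powr \<alpha>)
      = (LBINT u=ereal 0..ereal d. deriv f (x - s * u) / u powr \<alpha>)"
    by (rule interval_integral_cong) (use d in \<open>auto simp: einterval_iff min_def\<close>)
  also have "\<dots> = integral {0..d} (\<lambda>u. deriv f (x - s * u) / u powr \<alpha>)"
  proof (rule interval_integral_eq_integral)
    have "continuous_on {0..d} (\<lambda>u. deriv f (x - s * u))"
      by (rule continuous_on_compose2[OF C1_differentiable_on_UNIV_real(2)[OF assms(1), of UNIV]])
         (auto intro!: continuous_intros)
    then show "set_integrable lborel {0..d} (\<lambda>u. deriv f (x - s * u) / u powr \<alpha>)"
      using assms(2) d by (intro set_integrable_continuous_div_powr) auto
  qed (use d in simp)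
  finally show ?thesis
    using assms(2) by (simp add: caputo_deriv_def s_def d_def)
qed

theorem corollary3p8:
  fixes f :: "real \<Rightarrow> real" and \<alpha> p L :: real
  assumes "f C1_differentiable_on UNIV"
    and "0 < \<alpha>" and "\<alpha> \<le> 1" and "0 < p" and "0 < L"
    and "Holder_smooth L p f"
  shows "\<forall>x c. x \<noteq> c \<longrightarrow>
    \<bar>deriv f x * (x - c) / (Gamma (2 - \<alpha>) * \<bar>x - c\<bar> powr \<alpha>) - caputo_deriv \<alpha> c f x\<bar>
      \<le> rGamma (1 - \<alpha>) * (L / (1 + p - \<alpha>)) * \<bar>x - c\<bar> powr (1 + p - \<alpha>)"
proof (intro allI impI)
  fix x c :: real assume "x \<noteq> c"
  define s d where "s = sgn (x - c)" and "d = \<bar>x - c\<bar>"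
  have abs_s: "\<bar>s\<bar> = 1" and s_cases: "s = 1 \<or> s = -1" and d: "0 < d" and xc: "x - c = s * d"
    using \<open>x \<noteq> c\<close> by (auto simp: s_def d_def sgn_if)
  show "\<bar>deriv f x * (x - c) / (Gamma (2 - \<alpha>) * \<bar>x - c\<bar> powr \<alpha>) - caputo_deriv \<alpha> c f x\<bar>
      \<le> rGamma (1 - \<alpha>) * (L / (1 + p - \<alpha>)) * \<bar>x - c\<bar> powr (1 + p - \<alpha>)"
  proof (cases "\<alpha> = 1")
    case True
    then show ?thesis
      using \<open>x \<noteq> c\<close> by (auto simp: caputo_deriv_def sgn_if divide_simps algebra_simps)
  next
    case False
    then have \<alpha>: "\<alpha> < 1" using assms(3) by simp
    define G where "G = Gamma (1 - \<alpha>)"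
    have G: "0 < G" using \<alpha> by (simp add: G_def Gamma_real_pos)
    have Gamma: "Gamma (2 - \<alpha>) = (1 - \<alpha>) * G"
      using Gamma_plus1[of "1 - \<alpha>"] \<alpha> nonpos_Ints_nonpos[of "1 - \<alpha>"]
      by (force simp: G_def algebra_simps)
    let ?I = "integral {0..d} (\<lambda>u. deriv f (x - s * u) / u powr \<alpha>)"
    let ?h = "\<lambda>u. deriv f x - deriv f (x - s * u)"
    let ?\<phi> = "\<lambda>u. deriv f x * u + s * (f (x - s * u) - f x)"
    note C1 = C1_differentiable_on_UNIV_real[OF assms(1)]
    have cont: "continuous_on {0..d} (\<lambda>u. deriv f (x - s * u))"
      by (rule continuous_on_compose2[OF C1(2)[of UNIV]]) (auto intro!: continuous_intros)
    have deriv: "(?\<phi> has_real_derivative ?h u) (at u)" for u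
      by (rule derivative_eq_intros DERIV_chain2[OF C1(1)] refl)+ (use s_cases in auto)
    have "\<bar>integral {0..d} (\<lambda>u. ?h u / u powr \<alpha>)\<bar>
        \<le> L / (1 + p) * (1 + p) / (1 + p - \<alpha>) * d powr (1 + p - \<alpha>)"
    proof (rule weighted_integral_deriv_bound)
      show "continuous_on {0..d} ?h"
        by (intro continuous_intros cont)
      show "continuous_on {0..d} ?\<phi>"
        by (rule DERIV_continuous_on) (use deriv has_field_derivative_at_within in blast)
      fix u :: real assume u: "0 \<le> u"
      have "\<bar>?\<phi> u\<bar> = \<bar>f (x - s * u) - f x - deriv f x * ((x - s * u) - x)\<bar>"
        using s_cases by auto
      also have "\<dots> \<le> L / (1 + p) * \<bar>(x - s * u) - x\<bar> powr (1 + p)"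
        using assms(6) unfolding Holder_smooth_def by blast
      finally show "\<bar>?\<phi> u\<bar> \<le> L / (1 + p) * u powr (1 + p)"
        using u abs_s by (simp add: abs_mult)
    qed (use deriv \<alpha> assms d in auto)
    then have bound: "\<bar>integral {0..d} (\<lambda>u. ?h u / u powr \<alpha>)\<bar>
        \<le> L / (1 + p - \<alpha>) * d powr (1 + p - \<alpha>)"
      using assms by simp
    have "((\<lambda>u. u powr (-\<alpha>)) has_integral d powr (1 - \<alpha>) / (1 - \<alpha>)) {0..d}"
      using has_integral_powr_from_0[of "-\<alpha>" d] \<alpha> d by simp
    from has_integral_mult_right[OF this, of "deriv f x"]
    have tangent: "((\<lambda>u. deriv f x / u powr \<alpha>) has_integral
        deriv f x * d powr (1 - \<alpha>) / (1 - \<alpha>)) {0..d}"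
      by (simp add: powr_minus divide_inverse mult.assoc)
    have "((\<lambda>u. deriv f (x - s * u) / u powr \<alpha>) has_integral ?I) {0..d}"
      by (intro integrable_integral
            set_borel_integral_eq_integral(1)[OF set_integrable_continuous_div_powr])
         (use cont \<alpha> d in auto)
    from integral_unique[OF has_integral_diff[OF tangent this]]
    have difference: "integral {0..d} (\<lambda>u. ?h u / u powr \<alpha>)
        = deriv f x * d powr (1 - \<alpha>) / (1 - \<alpha>) - ?I"
      by (simp add: diff_divide_distrib)
    have "deriv f x * (s * d) / (Gamma (2 - \<alpha>) * d powr \<alpha>)
        = s / G * (deriv f x * d powr (1 - \<alpha>) / (1 - \<alpha>))"
      using d G \<alpha> by (simp add: Gamma powr_diff field_simps)
    moreover have "caputo_deriv \<alpha> c f x = s / G * ?I"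
      using caputo_deriv_by_distance[OF assms(1) \<alpha> \<open>x \<noteq> c\<close>] by (simp add: s_def d_def G_def)
    ultimately have "\<bar>deriv f x * (s * d) / (Gamma (2 - \<alpha>) * d powr \<alpha>) - caputo_deriv \<alpha> c f x\<bar>
        = \<bar>s / G * integral {0..d} (\<lambda>u. ?h u / u powr \<alpha>)\<bar>"
      by (simp add: difference right_diff_distrib)
    also have "\<dots> = inverse G * \<bar>integral {0..d} (\<lambda>u. ?h u / u powr \<alpha>)\<bar>"
      using G abs_s by (simp add: abs_mult abs_divide divide_inverse)
    also have "\<dots> \<le> inverse G * (L / (1 + p - \<alpha>) * d powr (1 + p - \<alpha>))"
      by (rule mult_left_mono[OF bound]) (use G in simp)
    finally show ?thesis
      by (simp add: xc[symmetric] d_def[symmetric] G_def rGamma_inverse_Gamma mult.assoc)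
  qed
qed

end
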